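(* Let $V:\mathbf{R}^d\to\mathbf{R}$ be a convex $\mathrm{C}^1$ function and let $\mathcal{V}(\mu):=\int V(x)\,\mathrm{d}\mu(x)$ for $\mu\in\mathcal{P}_2(\mathbf{R}^d)$. Then $\mathcal{V}$ is transport convex, where the gradient of $\mathcal{V}$ is $\mathcal{G}_{\mathcal{V}}[\mu](x)=\nabla V(x)$.
   Context: $\mathcal{P}_2(\mathbf{R}^d)$ is the set of probability measures on $\mathbf{R}^d$ with finite second-order moment; $F_\#\mu$ is the push-forward of $\mu$ by $F$; $L^2(\mathbf{R}^d\to\mathbf{R}^d)$ is the set of maps $\mathbf{R}^d\to\mathbf{R}^d$ that are square integrable with respect to the base measure $\mu$. Transport convex: a functional $\mathcal{F}:\mathcal{P}_2(\mathbf{R}^d)\to\mathbf{R}$ with gradient $\mathcal{G}_{\mathcal{F}}:\mathcal{P}_2(\mathbf{R}^d)\times\mathbf{R}^d\to\mathbf{R}^d$ is transport convex if $\mathcal{F}(T_\#\mu)-\mathcal{F}(S_\#\mu)\ge\int\langle\mathcal{G}_{\mathcal{F}}[S_\#\mu](S(x)),T(x)-S(x)\rangle\,\mathrm{d}\mu(x)$ for any $S,T\in L^2(\mathbf{R}^d\to\mathbf{R}^d)$ and $\mu\in\mathcal{P}_2(\mathbf{R}^d)$. (Functionals are understood to be real-valued on $\mathcal{P}_2(\mathbf{R}^d)$.) *)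

theory Defs
  imports "HOL-Probability.Probability"
begin

definition P2 :: "(real ^ 'n) measure set" where
  "P2 = {\<mu>. prob_space \<mu> \<and> sets \<mu> = sets borel \<and> integrable \<mu> (\<lambda>x. (norm x)\<^sup>2)}"

definition L2_maps :: "(real ^ 'n) measure \<Rightarrow> (real ^ 'n \<Rightarrow> real ^ 'n) set" where
  "L2_maps \<mu> = {T. T \<in> borel_measurable \<mu> \<and> integrable \<mu> (\<lambda>x. (norm (T x))\<^sup>2)}"

text \<open>The gradient \<open>G\<close> of \<open>F\<close> is data of the notion. The integrability conjunct says that the
  integral in the inequality exists; without it the Bochner integral would silently be \<open>0\<close>.\<close>

definition transport_convex ::
  "((real ^ 'n) measure \<Rightarrow> real) \<Rightarrow> ((real ^ 'n) measure \<Rightarrow> real ^ 'n \<Rightarrow> real ^ 'n) \<Rightarrow> bool" where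
  "transport_convex F G \<longleftrightarrow>
    (\<forall>\<mu>\<in>P2. \<forall>S\<in>L2_maps \<mu>. \<forall>T\<in>L2_maps \<mu>.
      integrable \<mu> (\<lambda>x. G (distr \<mu> borel S) (S x) \<bullet> (T x - S x)) \<and>
      F (distr \<mu> borel T) - F (distr \<mu> borel S)
        \<ge> (\<integral>x. G (distr \<mu> borel S) (S x) \<bullet> (T x - S x) \<partial>\<mu>))"

text \<open>Real-valued only for those \<open>V\<close> that are integrable with respect to every measure in
  \<^const>\<open>P2\<close>; this has to be assumed separately.\<close>

definition potential_functional :: "(real ^ 'n \<Rightarrow> real) \<Rightarrow> (real ^ 'n) measure \<Rightarrow> real" where
  "potential_functional V \<mu> = (\<integral>x. V x \<partial>\<mu>)"

end

theory Submission
  imports Defs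
begin

text \<open>
  Convexity gives \<open>V (S x) - V (2 S x - T x) \<le> \<nabla>V (S x) \<bullet> (T x - S x) \<le> V (T x) - V (S x)\<close>.
  Since \<open>S\<close>, \<open>T\<close> and \<open>2 S - T\<close> are all square integrable, both bounds are integrable, so the
  middle term is integrable without any growth assumption on \<open>\<nabla>V\<close>; integrating the right
  inequality is the claim.
\<close>

text \<open>Restricting \<open>V\<close> to the line through \<open>x\<close> and \<open>y\<close>
  reduces this to the tangent inequality for a convex function \<open>g\<close> of one real
  variable, taken at \<open>0\<close> and evaluated at \<open>1\<close>.\<close>

lemma convex_on_above_gradient:
  fixes V :: "'a::real_inner \<Rightarrow> real"
  assumes convex: "convex_on UNIV V" and deriv: "GDERIV V x :> D"
  shows "D \<bullet> (y - x) \<le> V y - V x"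
proof -
  define g where "g = (\<lambda>t::real. V (x + t *\<^sub>R (y - x)))"
  have "convex_on UNIV g"
  proof (rule convex_onI)
    fix t a b :: real
    assume t: "0 < t" "t < 1"
    have "g ((1 - t) *\<^sub>R a + t *\<^sub>R b)
        = V ((1 - t) *\<^sub>R (x + a *\<^sub>R (y - x)) + t *\<^sub>R (x + b *\<^sub>R (y - x)))"
      unfolding g_def by (intro arg_cong[where f = V]) (simp add: algebra_simps)
    also have "\<dots> \<le> (1 - t) * g a + t * g b"
      unfolding g_def using convex_onD[OF convex, of t] t by simp
    finally show "g ((1 - t) *\<^sub>R a + t *\<^sub>R b) \<le> (1 - t) * g a + t * g b" .
  qed simp
  moreover have "(g has_field_derivative (D \<bullet> (y - x))) (at 0)"
  proof -
    \<comment> \<open>The base point is left as the value of the line map at \<open>0\<close>, so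
      that the chain rule applies directly.\<close>
    have V: "(V has_derivative (\<lambda>h. h \<bullet> D)) (at (x + 0 *\<^sub>R (y - x)))"
      using deriv by (simp add: gderiv_def)
    have "((\<lambda>t. x + t *\<^sub>R (y - x)) has_derivative (\<lambda>t. t *\<^sub>R (y - x))) (at (0::real))"
      by (auto intro!: derivative_eq_intros)
    from has_derivative_compose[OF this V] show ?thesis
      by (simp add: g_def has_field_derivative_def inner_commute mult_commute_abs)
  qed
  ultimately have "g 1 - g 0 \<ge> (D \<bullet> (y - x)) * (1 - 0)"
    by (intro convex_on_imp_above_tangent[where A = UNIV]) auto
  then show ?thesis by (simp add: g_def)
qed

text \<open>The second moment of the push-forward is the integral of the squared norm of
  \<open>S\<close>. This lets integrability of \<open>V\<close> under all measures in
  \<open>P2\<close> be used for push-forwards.\<close>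

lemma distr_in_P2:
  assumes "\<mu> \<in> P2" "S \<in> L2_maps \<mu>"
  shows "distr \<mu> borel S \<in> P2"
  using assms unfolding P2_def L2_maps_def
  by (auto simp: integrable_distr_eq intro: prob_space.prob_space_distr)

lemma L2_maps_diff:
  assumes "S \<in> L2_maps \<mu>" "T \<in> L2_maps \<mu>"
  shows "(\<lambda>x. S x - T x) \<in> L2_maps \<mu>"
proof -
  have [measurable]: "S \<in> borel_measurable \<mu>" "T \<in> borel_measurable \<mu>"
    and int: "integrable \<mu> (\<lambda>x. (norm (S x))\<^sup>2)" "integrable \<mu> (\<lambda>x. (norm (T x))\<^sup>2)"
    using assms by (auto simp: L2_maps_def)
  have "integrable \<mu> (\<lambda>x. (norm (S x - T x))\<^sup>2)"
  proof (rule Bochner_Integration.integrable_bound)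
    show "integrable \<mu> (\<lambda>x. 2 * (norm (S x))\<^sup>2 + 2 * (norm (T x))\<^sup>2)"
      using int by simp
    \<comment> \<open>By the parallelogram law, the right side minus the left side is the squared
      norm of \<open>a + b\<close>.\<close>
    have "(norm (a - b))\<^sup>2 \<le> 2 * (norm a)\<^sup>2 + 2 * (norm b)\<^sup>2" for a b :: "real ^ 'a"
      using zero_le_power2[of "norm (a + b)"]
      by (simp add: power2_norm_eq_inner inner_add inner_diff inner_commute)
    then show "AE x in \<mu>. norm ((norm (S x - T x))\<^sup>2)
        \<le> norm (2 * (norm (S x))\<^sup>2 + 2 * (norm (T x))\<^sup>2)"
      by simp
  qed simp
  then show ?thesis by (simp add: L2_maps_def)
qed

theorem theorem4p3:
  fixes V :: "real ^ 'n \<Rightarrow> real" and gradV :: "real ^ 'n \<Rightarrow> real ^ 'n"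
  assumes "convex_on UNIV V"
    and "\<And>x. GDERIV V x :> gradV x"
    and "continuous_on UNIV gradV"
    and "\<And>\<mu>. \<mu> \<in> P2 \<Longrightarrow> integrable \<mu> V"
  shows "transport_convex (potential_functional V) (\<lambda>\<mu> x. gradV x)"
  unfolding transport_convex_def
proof (intro ballI)
  fix \<mu> :: "(real ^ 'n) measure" and S T
  assume \<mu>: "\<mu> \<in> P2" and S: "S \<in> L2_maps \<mu>" and T: "T \<in> L2_maps \<mu>"
  have [measurable]: "S \<in> borel_measurable \<mu>" "T \<in> borel_measurable \<mu>"
    using S T by (auto simp: L2_maps_def)
  have [measurable]: "gradV \<in> borel_measurable borel"
    using assms(3) by (rule borel_measurable_continuous_onI)
  have "continuous_on UNIV V"
    using assms(1) by (intro convex_on_continuous) auto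
  then have [measurable]: "V \<in> borel_measurable borel"
    by (rule borel_measurable_continuous_onI)
  have tangent: "gradV x \<bullet> (y - x) \<le> V y - V x" for x y
    by (rule convex_on_above_gradient[OF assms(1,2)])
  \<comment> \<open>Integrability of \<open>V\<close> under the push-forward of \<open>\<mu>\<close>
    by \<open>R\<close>, pulled back to \<open>\<mu>\<close>.\<close>
  have V_comp: "integrable \<mu> (\<lambda>x. V (R x))" if "R \<in> L2_maps \<mu>" for R
    using assms(4)[OF distr_in_P2[OF \<mu> that]] that
    by (auto simp: L2_maps_def integrable_distr_eq)
  \<comment> \<open>\<open>R x\<close> is the reflection of \<open>T x\<close> through
    \<open>S x\<close>; as a nested difference it is covered by \<open>L2_maps_diff\<close>.\<close>
  define R where "R = (\<lambda>x. S x - (T x - S x))"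
  have "R \<in> L2_maps \<mu>"
    unfolding R_def by (intro L2_maps_diff S T)
  note int = V_comp[OF S] V_comp[OF T] V_comp[OF this]
  let ?f = "\<lambda>x. gradV (S x) \<bullet> (T x - S x)"
  have upper: "?f x \<le> V (T x) - V (S x)" for x
    by (rule tangent)
  \<comment> \<open>Since \<open>R x - S x\<close> is the negative of \<open>T x - S x\<close>, the
    tangent inequality from \<open>S x\<close> to \<open>R x\<close> bounds \<open>?f x\<close> from
    below.\<close>
  have lower: "V (S x) - V (R x) \<le> ?f x" for x
    using tangent[of "S x" "R x"] by (simp add: R_def inner_diff_right)
  have "integrable \<mu> ?f"
  proof (rule Bochner_Integration.integrable_bound)
    \<comment> \<open>A number between two bounds has absolute value at most the sum of their
      absolute values.\<close>
    show "integrable \<mu> (\<lambda>x. \<bar>V (T x) - V (S x)\<bar> + \<bar>V (S x) - V (R x)\<bar>)"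
      using int by simp
    show "AE x in \<mu>. norm (?f x) \<le> norm (\<bar>V (T x) - V (S x)\<bar> + \<bar>V (S x) - V (R x)\<bar>)"
    proof (rule AE_I2)
      fix x
      show "norm (?f x) \<le> norm (\<bar>V (T x) - V (S x)\<bar> + \<bar>V (S x) - V (R x)\<bar>)"
        using upper[of x] lower[of x] by simp
    qed
  qed simp
  moreover from this have "(\<integral>x. ?f x \<partial>\<mu>) \<le> (\<integral>x. V (T x) - V (S x) \<partial>\<mu>)"
    using int upper by (intro integral_mono) auto
  ultimately show "integrable \<mu> ?f \<and> (\<integral>x. ?f x \<partial>\<mu>)
      \<le> potential_functional V (distr \<mu> borel T) - potential_functional V (distr \<mu> borel S)"
    using int by (simp add: potential_functional_def integral_distr)
qed

end
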